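(* The covering density of the positive definite quadratic form $Q^{c1}_6$ is at most $2.464801$, i.e. $\Theta(Q_6^{c1})\le 2.464801$.
   Context: For a positive definite quadratic form (PQF) $Q$, i.e. a positive definite real symmetric $d\times d$ matrix with $Q[x]=x^tQx$, put $\mu(Q)=\max_{x\in\mathbb{R}^d}\min_{v\in\mathbb{Z}^d}Q[x-v]$ and $\Theta(Q)=\sqrt{\mu(Q)^d/\det Q}\cdot\kappa_d$, with $\kappa_d$ the volume of the $d$-dimensional unit ball. A polytope $\mathrm{conv}\{v_1,\dots,v_n\}$ with $v_i\in\mathbb{Z}^d$ is a Delone polytope of $Q$ if there are $c\in\mathbb{R}^d$, $r\in\mathbb{R}$ with $Q[v_i-c]=r^2$ for all $i$ and $Q[v-c]>r^2$ for all other $v\in\mathbb{Z}^d$. $\mathrm{Del}(Q)$ is the set of all Delone polytopes of $Q$; it is a Delone triangulation if it consists of simplices only. For a Delone triangulation $\mathcal{D}$, its secondary cone is $\mathbf{\Delta}(\mathcal{D})=\{Q \text{ a PQF}:\mathrm{Del}(Q)=\mathcal{D}\}$, with closure $\overline{\mathbf{\Delta}(\mathcal{D})}$; on the PQFs in $\overline{\mathbf{\Delta}(\mathcal{D})}$ the minimizer of $\Theta$ exists and is unique up to positive multiples. Put $$Q_{\mathsf{E}_6^*}=\begin{pmatrix}4&1&2&2&-1&1\\1&4&2&2&2&1\\2&2&4&1&1&2\\2&2&1&4&1&2\\-1&2&1&1&4&2\\1&1&2&2&2&4\end{pmatrix},\quad R_2=\begin{pmatrix}0&0&0&0&0&0\\0&5&2&2&3&1\\0&2&4&0&2&2\\0&2&0&4&2&2\\0&3&2&2&5&3\\0&1&2&2&3&5\end{pmatrix},$$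 $$R_3=\begin{pmatrix}6&4&4&4&0&2\\4&11&6&6&5&3\\4&6&8&3&3&4\\4&6&3&8&3&4\\0&5&3&3&7&4\\2&3&4&4&4&7\end{pmatrix},\quad R_4=\begin{pmatrix}3&2&2&2&0&1\\2&3&2&2&1&1\\2&2&4&1&1&2\\2&2&1&4&1&2\\0&1&1&1&3&2\\1&1&2&2&2&4\end{pmatrix}.$$ Let $\mathcal{D}^{c1}$ be the Delone triangulation of the PQF $Q_{\mathsf{E}_6^*}+xR_2+yR_3+zR_4$ with $x=0.15266328480099$, $y=0.32884740614948$, $z=0.13827491241153$. Then $Q_6^{c1}$ denotes the (unique up to positive multiples) minimizer of $\Theta$ on the PQFs in $\overline{\mathbf{\Delta}(\mathcal{D}^{c1})}$. *)

theory Defs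
  imports "HOL-Analysis.Analysis"
begin

definition pqf :: "real ^ 'n ^ 'n \<Rightarrow> bool" where
  "pqf Q \<longleftrightarrow> transpose Q = Q \<and> (\<forall>x. x \<noteq> 0 \<longrightarrow> x \<bullet> (Q *v x) > 0)"

definition qval :: "real ^ 'n ^ 'n \<Rightarrow> real ^ 'n \<Rightarrow> real" where
  "qval Q x = x \<bullet> (Q *v x)"

definition int_lattice :: "(real ^ 'n) set" where
  "int_lattice = {v. \<forall>i. v $ i \<in> \<int>}"

text \<open>For a PQF the supremum and the infimum are attained, so that they are the
  maximum and the minimum.\<close>

definition inhomogeneous_min :: "real ^ 'n ^ 'n \<Rightarrow> real" where
  "inhomogeneous_min Q = (SUP x. INF v\<in>int_lattice. qval Q (x - v))"

definition covering_density :: "real ^ 'n ^ 'n \<Rightarrow> real" where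
  "covering_density Q =
     sqrt (inhomogeneous_min Q ^ CARD('n) / det Q) * measure lborel (cball (0 :: real ^ 'n) 1)"

text \<open>Delone polytopes need not be full-dimensional: the faces of a Delone polytope are
  Delone polytopes as well.\<close>

definition Del :: "real ^ 'n ^ 'n \<Rightarrow> (real ^ 'n) set set" where
  "Del Q = {convex hull V | V. finite V \<and> V \<noteq> {} \<and> V \<subseteq> int_lattice \<and>
     (\<exists>c r. (\<forall>v\<in>V. qval Q (v - c) = r\<^sup>2) \<and> (\<forall>v\<in>int_lattice - V. qval Q (v - c) > r\<^sup>2))}"

text \<open>The definition makes sense for every set of polytopes; it is applied to Delone
  triangulations.\<close>

definition secondary_cone :: "(real ^ 'n) set set \<Rightarrow> (real ^ 'n ^ 'n) set" where
  "secondary_cone D = {Q. pqf Q \<and> Del Q = D}"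

definition Q_E6_dual :: "real ^ 6 ^ 6" where
  "Q_E6_dual = vector
    [vector [ 4, 1, 2, 2, -1, 1],
     vector [ 1, 4, 2, 2,  2, 1],
     vector [ 2, 2, 4, 1,  1, 2],
     vector [ 2, 2, 1, 4,  1, 2],
     vector [-1, 2, 1, 1,  4, 2],
     vector [ 1, 1, 2, 2,  2, 4]]"

definition R2 :: "real ^ 6 ^ 6" where
  "R2 = vector
    [vector [0, 0, 0, 0, 0, 0],
     vector [0, 5, 2, 2, 3, 1],
     vector [0, 2, 4, 0, 2, 2],
     vector [0, 2, 0, 4, 2, 2],
     vector [0, 3, 2, 2, 5, 3],
     vector [0, 1, 2, 2, 3, 5]]"

definition R3 :: "real ^ 6 ^ 6" where
  "R3 = vector
    [vector [6,  4, 4, 4, 0, 2],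
     vector [4, 11, 6, 6, 5, 3],
     vector [4,  6, 8, 3, 3, 4],
     vector [4,  6, 3, 8, 3, 4],
     vector [0,  5, 3, 3, 7, 4],
     vector [2,  3, 4, 4, 4, 7]]"

definition R4 :: "real ^ 6 ^ 6" where
  "R4 = vector
    [vector [3, 2, 2, 2, 0, 1],
     vector [2, 3, 2, 2, 1, 1],
     vector [2, 2, 4, 1, 1, 2],
     vector [2, 2, 1, 4, 1, 2],
     vector [0, 1, 1, 1, 3, 2],
     vector [1, 1, 2, 2, 2, 4]]"

definition D_c1 :: "(real ^ 6) set set" where
  "D_c1 = Del (Q_E6_dual + 0.15266328480099 *\<^sub>R R2
                         + 0.32884740614948 *\<^sub>R R3
                         + 0.13827491241153 *\<^sub>R R4)"

text \<open>The form is determined only up to positive multiples, hence a predicate.\<close>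

definition is_Q6_c1 :: "real ^ 6 ^ 6 \<Rightarrow> bool" where
  "is_Q6_c1 = is_arg_min covering_density (\<lambda>Q. pqf Q \<and> Q \<in> closure (secondary_cone D_c1))"

end

(* The form defining the triangulation lies in its own secondary cone, so the minimizer of Theta does
   at least as well as this form, whose covering density is about 2.46480067. Its covering radius is
   bounded without Voronoi cells. Let p_S(x) be Q[x] minus the affine function that interpolates Q at
   the vertices of a Delone simplex S. For a given x take the simplex S with the least p_S(x). If x
   were outside S, crossing a facet that separates S from x would decrease p_S(x), because the vertex
   of S opposite to that facet lies outside the circumscribed ellipsoid of the neighbour. So x is
   in S, and averaging Q[v - x] over the vertices v of S with the barycentric weights of x shows that
   some vertex v has Q[v - x] at most r^2 whenever a ball of radius r contains all vertices of S.
   Modulo automorphisms and translations only eight simplices and their 56 facets are left to check,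
   by integer arithmetic. *)
theory Submission
  imports Defs
begin

section \<open>Quadratic forms\<close>

lemma qval_add:
  assumes "transpose Q = Q"
  shows "qval Q (x + y) = qval Q x + 2 * (x \<bullet> (Q *v y)) + qval Q y"
proof -
  have "y \<bullet> (Q *v x) = x \<bullet> (Q *v y)"
    using assms by (metis dot_lmul_matrix inner_commute vector_transpose_matrix)
  then show ?thesis
    by (simp add: qval_def matrix_vector_right_distrib inner_add_left inner_add_right)
qed

lemma qval_scaleR: "qval Q (c *\<^sub>R x) = c\<^sup>2 * qval Q x"
  by (simp add: qval_def matrix_vector_mult_scaleR power2_eq_square)

lemma qval_nonneg: "pqf Q \<Longrightarrow> 0 \<le> qval Q x"
  by (cases "x = 0") (auto simp: pqf_def qval_def less_imp_le)

lemma qval_minus: "qval Q (- x) = qval Q x"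
  using qval_scaleR[of Q "-1" x] by simp

text \<open>The continuous \<open>qval Q\<close> attains a positive minimum on the compact unit
  sphere; homogeneity of degree two extends the bound to all vectors.\<close>

lemma pqf_coercive:
  assumes "pqf Q"
  obtains m where "m > 0" "\<And>x. m * (norm x)\<^sup>2 \<le> qval Q x"
proof -
  have cont: "continuous_on (sphere 0 1) (qval Q)"
    unfolding qval_def
    by (intro continuous_intros linear_continuous_on matrix_vector_mul_bounded_linear)
  have "sphere (0::real^'a) 1 \<noteq> {}"
    by simp
  then obtain u where u: "u \<in> sphere 0 1" "\<And>x. x \<in> sphere 0 1 \<Longrightarrow> qval Q u \<le> qval Q x"
    using continuous_attains_inf[OF compact_sphere _ cont] by blast
  have "qval Q u > 0"
    using assms u(1) by (auto simp: pqf_def qval_def dest!: spec[of _ u])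
  moreover have "qval Q u * (norm x)\<^sup>2 \<le> qval Q x" for x
  proof (cases "x = 0")
    case False
    then have "qval Q u \<le> qval Q ((1 / norm x) *\<^sub>R x)"
      by (intro u(2)) simp
    with False show ?thesis
      by (simp add: qval_scaleR field_simps)
  qed (simp add: qval_def)
  ultimately show ?thesis
    using that by blast
qed

text \<open>Quadratic growth beats affine growth. Sets where \<open>pow\<close> is bounded above
  have this form, so they contain only finitely many lattice points.\<close>

lemma pqf_sublevel_bounded:
  assumes "pqf Q"
  shows "bounded {x. qval Q x \<le> a + w \<bullet> x}"
proof -
  obtain m where m: "m > 0" "\<And>x. m * (norm x)\<^sup>2 \<le> qval Q x"
    using pqf_coercive[OF assms] by blast
  \<comment> \<open>Outside the unit ball the constant \<open>\<bar>a\<bar>\<close> is at most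
    \<open>\<bar>a\<bar> * norm x\<close>, so one factor \<open>norm x\<close> cancels.\<close>
  have "norm x \<le> max 1 ((\<bar>a\<bar> + norm w) / m)" if "qval Q x \<le> a + w \<bullet> x" for x
  proof (cases "norm x \<le> 1")
    case False
    have "m * norm x * norm x \<le> a + w \<bullet> x"
      using m(2)[of x] that by (simp add: power2_eq_square)
    also have "\<dots> \<le> \<bar>a\<bar> * 1 + norm w * norm x"
      using norm_cauchy_schwarz[of w x] by linarith
    also have "\<dots> \<le> \<bar>a\<bar> * norm x + norm w * norm x"
      using False by (intro add_right_mono mult_left_mono) auto
    finally have "(m * norm x) * norm x \<le> (\<bar>a\<bar> + norm w) * norm x"
      by (simp only: distrib_right)
    then have "m * norm x \<le> \<bar>a\<bar> + norm w"
      using False by (elim mult_right_le_imp_le) linarith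
    then have "norm x \<le> (\<bar>a\<bar> + norm w) / m"
      using m(1) by (simp add: field_simps)
    then show ?thesis by simp
  qed simp
  then show ?thesis
    by (intro boundedI) blast
qed

text \<open>Parallel axis identity: expanding around \<open>y\<close>, the cross terms cancel
  because the weighted sum of the \<open>v j - y\<close> is zero.\<close>

lemma qval_barycentric:
  assumes "transpose Q = Q" "(\<Sum>j\<in>J. l j) = 1" "(\<Sum>j\<in>J. l j *\<^sub>R v j) = y"
  shows "(\<Sum>j\<in>J. l j * qval Q (v j - c)) = qval Q (y - c) + (\<Sum>j\<in>J. l j * qval Q (v j - y))"
proof -
  have "(\<Sum>j\<in>J. l j * qval Q (v j - c))
      = (\<Sum>j\<in>J. l j * qval Q (v j - y) + 2 * ((l j *\<^sub>R v j - l j *\<^sub>R y) \<bullet> (Q *v (y - c)))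
          + l j * qval Q (y - c))"
  proof (rule sum.cong)
    fix j
    show "l j * qval Q (v j - c)
      = l j * qval Q (v j - y) + 2 * ((l j *\<^sub>R v j - l j *\<^sub>R y) \<bullet> (Q *v (y - c)))
          + l j * qval Q (y - c)"
      using qval_add[OF assms(1), of "v j - y" "y - c"]
      by (auto simp: scaleR_diff_right[symmetric] distrib_left)
  qed simp
  also have "\<dots> = (\<Sum>j\<in>J. l j * qval Q (v j - y))
      + 2 * (((\<Sum>j\<in>J. l j *\<^sub>R v j) - (\<Sum>j\<in>J. l j) *\<^sub>R y) \<bullet> (Q *v (y - c)))
      + (\<Sum>j\<in>J. l j) * qval Q (y - c)"
    by (simp add: sum.distrib scaleR_sum_left inner_sum_left sum_distrib_left sum_distrib_right inner_diff_left sum_subtractf)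
  finally show ?thesis
    using assms by simp
qed

section \<open>Integral points and integral automorphisms\<close>

lemma int_lattice_add: "x \<in> int_lattice \<Longrightarrow> y \<in> int_lattice \<Longrightarrow> x + y \<in> int_lattice"
  and int_lattice_diff: "x \<in> int_lattice \<Longrightarrow> y \<in> int_lattice \<Longrightarrow> x - y \<in> int_lattice"
  and zero_in_int_lattice: "0 \<in> int_lattice"
  by (auto simp: int_lattice_def)

lemma finite_vec_components:
  assumes "finite S"
  shows "finite {x :: 'a ^ 'n. \<forall>i. x $ i \<in> S}"
proof -
  have "finite (PiE (UNIV :: 'n set) (\<lambda>_. S))"
    using assms by (intro finite_PiE) auto
  moreover have "{x :: 'a ^ 'n. \<forall>i. x $ i \<in> S} \<subseteq> vec_lambda ` PiE UNIV (\<lambda>_. S)"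
    by (auto intro!: image_eqI[where x = "vec_nth _"])
  ultimately show ?thesis
    using finite_subset by blast
qed

lemma finite_int_lattice_bounded:
  assumes "bounded S"
  shows "finite (S \<inter> (int_lattice :: (real ^ 'n) set))"
proof -
  obtain B where B: "\<And>x. x \<in> S \<Longrightarrow> norm x \<le> B"
    using assms bounded_iff by blast
  have "S \<inter> int_lattice \<subseteq> {x. \<forall>i. x $ i \<in> {a. a \<in> \<int> \<and> \<bar>a\<bar> \<le> B}}"
    using B by (auto simp: int_lattice_def) (meson component_le_norm_cart order_trans)
  then show ?thesis
    using finite_vec_components[OF finite_abs_int_segment] finite_subset by blast
qed

definition integral_auts :: "real ^ 'n ^ 'n \<Rightarrow> (real ^ 'n ^ 'n) set" where
  "integral_auts Q = {g. (\<forall>i j. g $ i $ j \<in> \<int>) \<and> transpose g ** Q ** g = Q}"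

lemma integral_auts_qval: "g \<in> integral_auts Q \<Longrightarrow> qval Q (g *v x) = qval Q x"
proof -
  assume "g \<in> integral_auts Q"
  then have "qval Q x = x \<bullet> ((transpose g ** Q ** g) *v x)"
    unfolding integral_auts_def qval_def by simp
  also have "\<dots> = x \<bullet> (transpose g *v (Q *v (g *v x)))"
    by (simp only: matrix_vector_mul_assoc matrix_mul_assoc)
  also have "\<dots> = qval Q (g *v x)"
    by (simp add: qval_def inner_commute[of x] transpose_matrix_vector dot_lmul_matrix)
      (simp add: inner_commute)
  finally show ?thesis by simp
qed

lemma integral_auts_int_lattice:
  "g \<in> integral_auts Q \<Longrightarrow> x \<in> int_lattice \<Longrightarrow> g *v x \<in> int_lattice"
  by (auto simp: integral_auts_def int_lattice_def matrix_vector_mult_def)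

lemma mat_1_in_integral_auts: "mat 1 \<in> integral_auts Q"
  by (auto simp: integral_auts_def transpose_mat mat_def[symmetric]) (auto simp: mat_def)

lemma integral_auts_mult:
  assumes "g \<in> integral_auts Q" "h \<in> integral_auts Q"
  shows "g ** h \<in> integral_auts Q"
proof -
  have "transpose (g ** h) ** Q ** (g ** h) = transpose h ** (transpose g ** Q ** g) ** h"
    by (simp add: matrix_transpose_mul matrix_mul_assoc)
  with assms show ?thesis
    by (auto simp: integral_auts_def matrix_matrix_mult_def)
qed

text \<open>The columns of an automorphism are images of the unit vectors, hence integral points on
  which \<open>Q\<close> is at most \<open>M\<close>.\<close>

lemma finite_integral_auts:
  fixes Q :: "real ^ 'n ^ 'n"
  assumes "pqf Q"
  shows "finite (integral_auts Q)"
proof -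
  define M where "M = Max (range (\<lambda>i. qval Q (axis i 1)))"
  \<comment> \<open>The zero linear term gives the set the shape required by
    \<open>pqf_sublevel_bounded\<close>.\<close>
  define S where "S = {x. qval Q x \<le> M + 0 \<bullet> x} \<inter> int_lattice"
  have "finite S"
    unfolding S_def by (intro finite_int_lattice_bounded pqf_sublevel_bounded assms)
  then have "finite (transpose ` {A :: real ^ 'n ^ 'n. \<forall>i. A $ i \<in> S})"
    by (intro finite_imageI finite_vec_components)
  moreover have "g \<in> transpose ` {A :: real ^ 'n ^ 'n. \<forall>i. A $ i \<in> S}" if g: "g \<in> integral_auts Q" for g
  proof (rule image_eqI)
    have "transpose g $ i \<in> S" for i
    proof -
      have *: "transpose g $ i = g *v axis i 1"
        by (simp add: matrix_vector_mult_basis row_def column_def transpose_def vec_eq_iff)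
      moreover have "axis i 1 \<in> int_lattice"
        by (auto simp: int_lattice_def axis_def)
      moreover have "qval Q (axis i 1) \<le> M"
        unfolding M_def by (intro Max_ge) auto
      ultimately show ?thesis
        using g by (simp add: S_def integral_auts_qval integral_auts_int_lattice)
    qed
    then show "transpose g \<in> {A :: real ^ 'n ^ 'n. \<forall>i. A $ i \<in> S}" by simp
  qed simp
  ultimately show ?thesis
    by (meson finite_subset subsetI)
qed

text \<open>An integral automorphism has an integral inverse because it generates a finite monoid.\<close>

lemma integral_auts_surj:
  fixes Q :: "real ^ 'n ^ 'n"
  assumes "pqf Q" "g \<in> integral_auts Q" "u \<in> int_lattice"
  obtains w where "w \<in> int_lattice" "g *v w = u"
proof -
  have kernel: "g *v x = 0 \<Longrightarrow> x = 0" for x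
    using integral_auts_qval[OF assms(2), of x] assms(1)
    by (metis inner_zero_left less_irrefl pqf_def qval_def)
  have "inj_on (\<lambda>h. g ** h) (integral_auts Q)"
  proof (rule inj_onI)
    fix h h' :: "real ^ 'n ^ 'n" assume "g ** h = g ** h'"
    then have "g *v (h *v x - h' *v x) = 0" for x
      by (simp add: matrix_vector_mul_assoc matrix_vector_mult_diff_distrib)
    then have "h *v x = h' *v x" for x
      using kernel[of "h *v x - h' *v x"] by simp
    then show "h = h'"
      by (simp add: matrix_eq)
  qed
  \<comment> \<open>An injective self-map of a finite set is onto, so some product
    \<open>g ** h\<close> equals \<open>mat 1\<close>.\<close>
  then have "(\<lambda>h. g ** h) ` integral_auts Q = integral_auts Q"
    by (intro endo_inj_surj finite_integral_auts assms) (auto intro: integral_auts_mult assms)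
  then obtain h where h: "h \<in> integral_auts Q" "g ** h = mat 1"
    using mat_1_in_integral_auts[of Q] by (smt (verit) imageE)
  show ?thesis
  proof
    show "h *v u \<in> int_lattice"
      using h assms by (blast intro: integral_auts_int_lattice)
    show "g *v (h *v u) = u"
      using h by (simp add: matrix_vector_mul_assoc)
  qed
qed

section \<open>Periodic families of simplices\<close>

text \<open>\<open>K\<close> indexes representatives of the simplices and \<open>J\<close> the
  vertices of each. The barycentric coordinates \<open>lam\<close> are affine functions on the whole
  space, negative beyond the opposite facet. Completing the square turns \<open>pow k y\<close> into
  \<open>qval Q (y - c)\<close> minus its value at the vertices, with \<open>c\<close> the
  circumcentre; so \<open>pow k\<close> is positive exactly outside the circumscribed ellipsoid. In
  \<open>crossing\<close> the neighbour across facet \<open>i\<close> is the simplex that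
  \<open>g\<close> and \<open>t\<close> map onto \<open>k'\<close>, and the inequality is the local
  Delone condition.\<close>

locale simplex_system =
  fixes Q :: "real ^ 'n ^ 'n"
    and K :: "'k set" and J :: "'j set"
    and vert :: "'k \<Rightarrow> 'j \<Rightarrow> real ^ 'n"
    and lam0 :: "'k \<Rightarrow> 'j \<Rightarrow> real" and lam1 :: "'k \<Rightarrow> 'j \<Rightarrow> real ^ 'n"
  fixes lam :: "'k \<Rightarrow> 'j \<Rightarrow> real ^ 'n \<Rightarrow> real"
  defines "lam k j y \<equiv> lam0 k j + lam1 k j \<bullet> y"
  fixes pow :: "'k \<Rightarrow> real ^ 'n \<Rightarrow> real"
  defines "pow k y \<equiv> qval Q y - (\<Sum>j\<in>J. lam k j y * qval Q (vert k j))"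
  assumes pqf: "pqf Q"
    and fin: "finite K" "K \<noteq> {}" "finite J"
    and vert_int: "k \<in> K \<Longrightarrow> j \<in> J \<Longrightarrow> vert k j \<in> int_lattice"
    and lam_sum: "k \<in> K \<Longrightarrow> (\<Sum>j\<in>J. lam k j y) = 1"
    and lam_vert: "k \<in> K \<Longrightarrow> (\<Sum>j\<in>J. lam k j y *\<^sub>R vert k j) = y"
    and lam_delta: "k \<in> K \<Longrightarrow> i \<in> J \<Longrightarrow> j \<in> J \<Longrightarrow> lam k i (vert k j) = of_bool (i = j)"
    and crossing: "k \<in> K \<Longrightarrow> i \<in> J \<Longrightarrow> \<exists>k'\<in>K. \<exists>g\<in>integral_auts Q. \<exists>t\<in>int_lattice.
      (\<forall>j\<in>J - {i}. g *v vert k j + t \<in> vert k' ` J) \<and> 0 < pow k' (g *v vert k i + t)"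
begin

lemma symm: "transpose Q = Q"
  using pqf by (simp add: pqf_def)

lemma pow_vert: "k \<in> K \<Longrightarrow> j \<in> J \<Longrightarrow> pow k (vert k j) = 0"
  using fin(3) by (simp add: pow_def lam_delta)

text \<open>The interpolating function is affine, so it commutes with barycentric combinations;
  \<open>qval Q\<close> contributes the correction from \<open>qval_barycentric\<close> with centre
  0.\<close>

lemma pow_barycentric:
  assumes "(\<Sum>j\<in>J. l j) = 1" "(\<Sum>j\<in>J. l j *\<^sub>R v j) = y"
  shows "pow k y = (\<Sum>j\<in>J. l j * pow k (v j)) - (\<Sum>j\<in>J. l j * qval Q (v j - y))"
proof -
  have affine: "lam k i y = (\<Sum>j\<in>J. l j * lam k i (v j))" for i
  proof -
    have "lam k i y = (\<Sum>j\<in>J. l j) * lam0 k i + lam1 k i \<bullet> (\<Sum>j\<in>J. l j *\<^sub>R v j)"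
      using assms by (simp add: lam_def)
    then show ?thesis
      by (simp add: lam_def inner_sum_right sum_distrib_right sum.distrib algebra_simps)
  qed
  have "(\<Sum>i\<in>J. lam k i y * qval Q (vert k i))
      = (\<Sum>j\<in>J. l j * (\<Sum>i\<in>J. lam k i (v j) * qval Q (vert k i)))"
    unfolding affine sum_distrib_right sum_distrib_left
    by (subst sum.swap) (simp add: mult.assoc)
  moreover have "qval Q y = (\<Sum>j\<in>J. l j * qval Q (v j)) - (\<Sum>j\<in>J. l j * qval Q (v j - y))"
    using qval_barycentric[OF symm assms, of 0] by simp
  ultimately show ?thesis
    by (simp add: pow_def sum_subtractf algebra_simps)
qed

text \<open>The quadratic parts of both sides agree, so their difference is affine in \<^term>\<open>y\<close>, and it
  vanishes at the vertices of the simplex \<^term>\<open>k\<close>.\<close>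

lemma pow_crossing:
  assumes k: "k \<in> K" "i \<in> J" "k' \<in> K" and g: "g \<in> integral_auts Q"
    and facet: "\<forall>j\<in>J - {i}. g *v vert k j + t \<in> vert k' ` J"
  shows "pow k' (g *v y + t) = pow k y + pow k' (g *v vert k i + t) * lam k i y"
proof -
  \<comment> \<open>An affine map preserves barycentric coordinates.\<close>
  have bary: "(\<Sum>j\<in>J. lam k j y *\<^sub>R (g *v vert k j + t)) = g *v y + t"
  proof -
    have "(\<Sum>j\<in>J. lam k j y *\<^sub>R (g *v vert k j + t))
        = g *v (\<Sum>j\<in>J. lam k j y *\<^sub>R vert k j) + (\<Sum>j\<in>J. lam k j y) *\<^sub>R t"
      by (simp add: scaleR_add_right sum.distrib scaleR_sum_left linear_sum
          matrix_vector_mult_scaleR)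
    then show ?thesis
      using k(1) by (simp add: lam_sum lam_vert)
  qed
  have zero: "pow k' (g *v vert k j + t) = 0" if "j \<in> J" "j \<noteq> i" for j
    using facet that pow_vert[OF k(3)] by (metis DiffI empty_iff imageE insert_iff)
  have "(\<Sum>j\<in>J. lam k j y * pow k' (g *v vert k j + t))
      = lam k i y * pow k' (g *v vert k i + t)"
    using k(2) fin(3) zero by (subst sum.remove[of _ i]) auto
  \<comment> \<open>As \<open>g\<close> preserves \<open>Q\<close>, the correction terms for
    \<open>k\<close> and for the moved simplex are equal, and only the vertex \<open>i\<close> makes
    a difference.\<close>
  moreover have "qval Q ((g *v vert k j + t) - (g *v y + t)) = qval Q (vert k j - y)" for j
    using integral_auts_qval[OF g, of "vert k j - y"] by (simp add: matrix_vector_mult_diff_distrib)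
  ultimately have "pow k' (g *v y + t)
      = lam k i y * pow k' (g *v vert k i + t) - (\<Sum>j\<in>J. lam k j y * qval Q (vert k j - y))"
    using pow_barycentric[OF lam_sum[OF k(1)] bary] by simp
  moreover have "pow k y = - (\<Sum>j\<in>J. lam k j y * qval Q (vert k j - y))"
    using pow_barycentric[OF lam_sum[OF k(1)] lam_vert[OF k(1)], of k] k(1) by (simp add: pow_vert)
  ultimately show ?thesis by simp
qed

text \<open>This yields a least copy among infinitely many: there are finitely many \<open>k\<close>
  and \<open>g\<close>, and for each pair the integral \<open>t\<close> lie in a translate of a
  bounded set.\<close>

lemma finite_low_pow:
  "finite {(k, g, t). k \<in> K \<and> g \<in> integral_auts Q \<and> t \<in> int_lattice \<and> pow k (g *v x + t) \<le> C}"
  (is "finite ?S")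
proof -
  have bdd: "bounded {y. pow k y \<le> C}" for k
  proof -
    have "{y. pow k y \<le> C} = {y. qval Q y \<le> (C + (\<Sum>j\<in>J. lam0 k j * qval Q (vert k j)))
        + (\<Sum>j\<in>J. qval Q (vert k j) *\<^sub>R lam1 k j) \<bullet> y}"
      by (simp add: pow_def lam_def inner_sum_left sum.distrib algebra_simps)
    then show ?thesis
      using pqf_sublevel_bounded[OF pqf] by simp
  qed
  have "finite (SIGMA k : K. SIGMA g : integral_auts Q.
      (\<lambda>y. y - g *v x) ` {y. pow k y \<le> C} \<inter> int_lattice)"
    by (intro finite_SigmaI fin finite_integral_auts pqf finite_int_lattice_bounded
        bounded_translation_minus bdd)
  moreover have "?S \<subseteq> \<dots>"
    by (auto intro!: image_eqI[where x = "_ + _"])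
  ultimately show ?thesis
    using finite_subset by blast
qed

text \<open>The point is moved instead of the simplices: \<open>g *v x + t\<close> lies in simplex
  \<open>k\<close> iff \<open>x\<close> lies in the corresponding copy of it. The triple
  \<open>(k, g, t)\<close> is chosen with the least value of \<open>pow\<close>.\<close>

lemma copies_cover:
  obtains k g t where "k \<in> K" "g \<in> integral_auts Q" "t \<in> int_lattice"
    "\<And>j. j \<in> J \<Longrightarrow> 0 \<le> lam k j (g *v x + t)"
proof -
  define P where "P = (\<lambda>(k, g, t). k \<in> K \<and> g \<in> integral_auts Q \<and> (t :: real ^ 'n) \<in> int_lattice)"
  define f where "f = (\<lambda>(k, g, t). pow k (g *v x + t))"
  obtain k0 where k0: "k0 \<in> K"
    using fin(2) by blast
  \<comment> \<open>The value at one arbitrary triple caps the search, leaving a finite nonempty set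
    whose minimum is global.\<close>
  define C where "C = f (k0, mat 1, 0)"
  have "finite {s. P s \<and> f s \<le> C}"
    using finite_low_pow[of x C] by (rule rev_finite_subset) (auto simp: P_def f_def)
  moreover have "(k0, mat 1, 0) \<in> {s. P s \<and> f s \<le> C}"
    by (simp add: P_def C_def k0 mat_1_in_integral_auts zero_in_int_lattice)
  ultimately obtain s where "is_arg_min f (\<lambda>s. s \<in> {s. P s \<and> f s \<le> C}) s"
    using ex_is_arg_min_if_finite[of "{s. P s \<and> f s \<le> C}" f] by blast
  then have s: "P s" "f s \<le> C" "\<And>s'. P s' \<Longrightarrow> f s' \<le> C \<Longrightarrow> f s \<le> f s'"
    by (auto simp: is_arg_min_linorder)
  have least: "P s' \<Longrightarrow> f s \<le> f s'" for s'
    using s(2) s(3)[of s'] by linarith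
  obtain k g t where kgt: "s = (k, g, t)"
    by (cases s)
  have P: "k \<in> K" "g \<in> integral_auts Q" "t \<in> int_lattice"
    using s(1) by (simp_all add: kgt P_def)
  moreover have "0 \<le> lam k i (g *v x + t)" if i: "i \<in> J" for i
  proof (rule ccontr)
    assume neg: "\<not> 0 \<le> lam k i (g *v x + t)"
    obtain k' g' t' where c: "k' \<in> K" "g' \<in> integral_auts Q" "t' \<in> int_lattice"
        "\<forall>j\<in>J - {i}. g' *v vert k j + t' \<in> vert k' ` J"
      and pos: "0 < pow k' (g' *v vert k i + t')"
      using crossing[OF P(1) i] by blast
    \<comment> \<open>Composing the motion with the crossing gives another admissible triple. By
      \<open>pow_crossing\<close> its value changes by a positive number times the negative
      coordinate.\<close>
    have "f (k', g' ** g, g' *v t + t') = pow k' (g' *v (g *v x + t) + t')"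
      by (simp add: f_def matrix_vector_mul_assoc matrix_vector_right_distrib add.assoc)
    also have "\<dots> < pow k (g *v x + t)"
      using pow_crossing[OF P(1) i c(1,2,4), of "g *v x + t"]
        mult_pos_neg[OF pos, of "lam k i (g *v x + t)"] neg by linarith
    finally have "f (k', g' ** g, g' *v t + t') < f s"
      by (simp add: f_def kgt)
    moreover have "P (k', g' ** g, g' *v t + t')"
      using c P by (simp add: P_def integral_auts_mult integral_auts_int_lattice int_lattice_add)
    ultimately show False
      using least by fastforce
  qed
  ultimately show thesis
    using that by blast
qed

text \<open>By \<open>qval_barycentric\<close> the weighted average of
  \<open>qval Q (vert k j - c)\<close> is least at \<open>c = y\<close>. Hence \<open>cen\<close>
  may be any point, and rounded circumcentres serve.\<close>

lemma near_int_lattice: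
  assumes radius: "\<And>k j. k \<in> K \<Longrightarrow> j \<in> J \<Longrightarrow> qval Q (vert k j - cen k) \<le> \<mu>"
  obtains u where "u \<in> int_lattice" "qval Q (x - u) \<le> \<mu>"
proof -
  obtain k g t where k: "k \<in> K" and g: "g \<in> integral_auts Q" and t: "t \<in> int_lattice"
    and nonneg: "\<And>j. j \<in> J \<Longrightarrow> 0 \<le> lam k j (g *v x + t)"
    using copies_cover[of x] by blast
  define y where "y = g *v x + t"
  have "\<exists>j\<in>J. qval Q (vert k j - y) \<le> \<mu>"
  proof (rule ccontr)
    assume far: "\<not> (\<exists>j\<in>J. qval Q (vert k j - y) \<le> \<mu>)"
    have "(\<Sum>j\<in>J. lam k j y * qval Q (vert k j - y)) \<le> (\<Sum>j\<in>J. lam k j y * qval Q (vert k j - cen k))"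
      using qval_barycentric[OF symm lam_sum[OF k] lam_vert[OF k], of y "cen k"]
        qval_nonneg[OF pqf, of "y - cen k"] by linarith
    also have "\<dots> \<le> (\<Sum>j\<in>J. lam k j y * \<mu>)"
      using radius k nonneg by (intro sum_mono mult_left_mono) (auto simp: y_def)
    finally have "(\<Sum>j\<in>J. lam k j y * (qval Q (vert k j - y) - \<mu>)) \<le> 0"
      by (simp add: sum_subtractf right_diff_distrib)
    \<comment> \<open>Nonnegative terms with sum at most 0 all vanish; the second factors are
      positive by \<open>far\<close>, so all weights would be 0 although they sum to 1.\<close>
    then have "\<forall>j\<in>J. lam k j y * (qval Q (vert k j - y) - \<mu>) = 0"
      using far nonneg fin(3)
      by (subst sum_nonneg_eq_0_iff[symmetric])
        (force simp: y_def intro!: mult_nonneg_nonneg antisym sum_nonneg)+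
    then have "\<forall>j\<in>J. lam k j y = 0"
      using far by fastforce
    then show False
      using lam_sum[OF k, of y] by simp
  qed
  then obtain j where j: "j \<in> J" "qval Q (vert k j - y) \<le> \<mu>" by blast
  \<comment> \<open>The near vertex is carried back along \<open>g\<close> and \<open>t\<close> to a
    lattice point near \<open>x\<close>.\<close>
  obtain u where u: "u \<in> int_lattice" "g *v u = vert k j - t"
    using integral_auts_surj[OF pqf g int_lattice_diff[OF vert_int[OF k j(1)] t]] .
  have "qval Q (x - u) = qval Q (g *v (x - u))"
    using integral_auts_qval[OF g] by simp
  also have "g *v (x - u) = - (vert k j - y)"
    by (simp add: matrix_vector_mult_diff_distrib u y_def)
  finally show thesis
    using that u j by (simp only: qval_minus)
qed

end

text \<open>The real \<open>SUP\<close> and \<open>INF\<close> can be estimated only for bounded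
  sets: nonnegativity of \<open>Q\<close> bounds the infima below and \<open>near\<close> bounds
  them above.\<close>

lemma inhomogeneous_min_bounds:
  fixes Q :: "real ^ 'n ^ 'n"
  assumes "pqf Q" and near: "\<And>x. \<exists>u\<in>int_lattice. qval Q (x - u) \<le> \<mu>"
  shows "0 \<le> inhomogeneous_min Q" "inhomogeneous_min Q \<le> \<mu>"
proof -
  define F where "F x = (INF v\<in>int_lattice. qval Q (x - v))" for x
  have F: "0 \<le> F x" "F x \<le> \<mu>" for x
  proof -
    show "0 \<le> F x"
      unfolding F_def using zero_in_int_lattice by (intro cINF_greatest) (auto simp: qval_nonneg assms)
    obtain u where u: "u \<in> int_lattice" "qval Q (x - u) \<le> \<mu>"
      using near by blast
    have "F x \<le> qval Q (x - u)"
      unfolding F_def using qval_nonneg[OF assms(1)] u by (intro cINF_lower bdd_belowI2[of _ 0]) auto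
    with u show "F x \<le> \<mu>" by simp
  qed
  have "F 0 \<le> (SUP x. F x)"
    using F by (intro cSUP_upper bdd_aboveI2[of _ _ \<mu>]) auto
  moreover have "(SUP x. F x) \<le> \<mu>"
    using F by (intro cSUP_least) auto
  ultimately show "0 \<le> inhomogeneous_min Q" "inhomogeneous_min Q \<le> \<mu>"
    using F(1)[of 0] by (simp_all add: inhomogeneous_min_def F_def)
qed

section \<open>Integer lists as vectors and matrices\<close>

definition dot :: "int list \<Rightarrow> int list \<Rightarrow> int" where
  "dot xs ys = sum_list (map2 (*) xs ys)"

definition mv :: "int list list \<Rightarrow> int list \<Rightarrow> int list" where
  "mv A xs = map (\<lambda>r. dot r xs) A"

definition col :: "nat \<Rightarrow> int list list \<Rightarrow> int list" where
  "col m A = map (\<lambda>r. r ! m) A"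

definition square6 :: "int list list \<Rightarrow> bool" where
  "square6 A \<longleftrightarrow> length A = 6 \<and> (\<forall>r\<in>set A. length r = 6)"

text \<open>The elements 1 to 6 go to list positions 0 to 5. In the type \<open>6\<close> the
  numerals 6 and 0 denote the same element, which falls under the last case.\<close>

definition idx :: "6 \<Rightarrow> nat" where
  "idx i = (if i = 1 then 0 else if i = 2 then 1 else if i = 3 then 2 else if i = 4 then 3
    else if i = 5 then 4 else 5)"

definition ivec :: "int list \<Rightarrow> real ^ 6" where
  "ivec xs = (\<chi> i. real_of_int (xs ! idx i))"

definition imat :: "int list list \<Rightarrow> real ^ 6 ^ 6" where
  "imat A = (\<chi> i j. real_of_int (A ! idx i ! idx j))"

lemma exhaust_6: "x = 1 \<or> x = 2 \<or> x = 3 \<or> x = 4 \<or> x = 5 \<or> x = 6" for x :: 6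
proof (induct x)
  case (of_int z)
  then have "z = 0 \<or> z = 1 \<or> z = 2 \<or> z = 3 \<or> z = 4 \<or> z = 5" by fastforce
  then show ?case by auto
qed

lemma forall_6: "(\<forall>i::6. P i) \<longleftrightarrow> P 1 \<and> P 2 \<and> P 3 \<and> P 4 \<and> P 5 \<and> P 6"
  by (metis exhaust_6)

lemma UNIV_6: "(UNIV :: 6 set) = {1, 2, 3, 4, 5, 6}"
  using exhaust_6 by auto

lemma distinct_6: "distinct [1, 2, 3, 4, 5, 6 :: 6]"
  by (simp add: bit0.Rep_inject_sym bit0.Rep_numeral bit0.Rep_1)

lemma sum_6: "sum f (UNIV :: 6 set) = f 1 + (f 2 + (f 3 + (f 4 + (f 5 + f 6))))"
  and prod_6: "prod g (UNIV :: 6 set) = g 1 * (g 2 * (g 3 * (g 4 * (g 5 * g 6))))"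
proof -
  have UNIV: "(UNIV :: 6 set) = set [1, 2, 3, 4, 5, 6]"
    by (simp add: UNIV_6)
  show "sum f (UNIV :: 6 set) = f 1 + (f 2 + (f 3 + (f 4 + (f 5 + f 6))))"
    unfolding UNIV sum.distinct_set_conv_list[OF distinct_6] by simp
  show "prod g (UNIV :: 6 set) = g 1 * (g 2 * (g 3 * (g 4 * (g 5 * g 6))))"
    unfolding UNIV prod.distinct_set_conv_list[OF distinct_6] by simp
qed

lemma idx_simps: "idx 1 = 0" "idx 2 = 1" "idx 3 = 2" "idx 4 = 3" "idx 5 = 4" "idx 6 = 5" "idx 0 = 5"
  using distinct_6 by (simp_all add: idx_def bit0.Rep_inject_sym bit0.Rep_numeral bit0.Rep_1 bit0.Rep_0)

lemma vector_6:
  "vector [a, b, c, d, e, f] $ (1::6) = a" "vector [a, b, c, d, e, f] $ (2::6) = b"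
  "vector [a, b, c, d, e, f] $ (3::6) = c" "vector [a, b, c, d, e, f] $ (4::6) = d"
  "vector [a, b, c, d, e, f] $ (5::6) = e" "vector [a, b, c, d, e, f] $ (6::6) = f"
  using distinct_6 by (simp_all add: vector_def)

lemma bij_idx: "bij_betw idx UNIV {..<6}"
  by (simp add: bij_betw_def inj_on_def forall_6 idx_simps UNIV_6 lessThan_nat_numeral lessThan_Suc insert_commute)

lemma idx_less: "idx i < 6"
  using bij_idx by (auto simp: bij_betw_def)

lemma idx_inj: "idx i = idx j \<longleftrightarrow> i = j"
  using bij_idx by (auto simp: bij_betw_def inj_on_def)

lemma sum_idx: "(\<Sum>i\<in>UNIV. f (idx i)) = (\<Sum>l<6. f l)"
  using sum.reindex_bij_betw[OF bij_idx] .

lemma dot_nth: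
  "length xs = n \<Longrightarrow> length ys = n \<Longrightarrow> dot xs ys = (\<Sum>l<n. xs ! l * ys ! l)"
  by (simp add: dot_def sum_list_sum_nth lessThan_atLeast0)

lemma inner_ivec:
  "length xs = 6 \<Longrightarrow> length ys = 6 \<Longrightarrow> ivec xs \<bullet> ivec ys = real_of_int (dot xs ys)"
  by (simp add: ivec_def inner_vec_def dot_nth sum_idx[of "\<lambda>l. real_of_int (xs ! l) * real_of_int (ys ! l)"])

lemma imat_ivec:
  assumes "square6 A" "length xs = 6"
  shows "imat A *v ivec xs = ivec (mv A xs)"
  using assms idx_less
  by (simp add: vec_eq_iff matrix_vector_mult_def imat_def ivec_def mv_def square6_def dot_nth[where n = 6]
      sum_idx[of "\<lambda>l. real_of_int (A ! idx _ ! l) * real_of_int (xs ! l)"])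

lemma ivec_add:
  "length xs = 6 \<Longrightarrow> length ys = 6 \<Longrightarrow> ivec xs + ivec ys = ivec (map2 (+) xs ys)"
  by (simp add: vec_eq_iff ivec_def idx_less)

lemma ivec_diff:
  "length xs = 6 \<Longrightarrow> length ys = 6 \<Longrightarrow> ivec xs - ivec ys = ivec (map2 (-) xs ys)"
  by (simp add: vec_eq_iff ivec_def idx_less)

lemma ivec_scale: "length xs = 6 \<Longrightarrow> real_of_int c *\<^sub>R ivec xs = ivec (map ((*) c) xs)"
  by (simp add: vec_eq_iff ivec_def idx_less)

lemma ivec_int_lattice: "ivec xs \<in> int_lattice"
  by (simp add: ivec_def int_lattice_def)

section \<open>The Delone simplices\<close>

text \<open>The entries are scaled by \<open>10 ^ 14\<close>.\<close>

definition gram :: "int list list" where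
  "gram =
   [[638790917413147, 259193944942098, 359193944942098, 359193944942098, -100000000000000,
     179596972471049],
    [259193944942098, 879546262888382, 455496083132192, 455496083132192, 424050179756190,
     227748041566096],
    [359193944942098, 455496083132192, 779453203804592, 212481713085997, 243014370046195,
     389726601902296],
    [359193944942098, 455496083132192, 212481713085997, 779453203804592, 243014370046195,
     389726601902296],
    [-100000000000000, 424050179756190, 243014370046195, 243014370046195, 748007300428590,
     404992930382395],
    [179596972471049, 227748041566096, 389726601902296, 389726601902296, 404992930382395,
     761834791669743]]"

text \<open>Representatives of the eight orbits of Delone simplices under integral automorphisms and
  translations; the group of automorphisms has order 240, and there are 720 simplices up to
  translation.\<close>

definition verts :: "int list list list" where
  "verts =
   [[[0, 0, 0, 0, 0, 0], [0, 0, 0, 1, 0, 0], [0, 1, 0, 0, 0, 0], [1, 0, -1, 0, 1, 0], [1, 0, 0, 0,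
     1, -1], [1, 1, -1, 0, 0, 0], [0, 1, -1, 0, 0, 0]],
    [[0, 0, 0, 1, 0, 0], [0, 1, 0, 0, 0, 0], [1, 0, -1, 0, 1, 0], [1, 0, 0, 0, 1, -1], [1, 1, -1,
     0, 0, 0], [0, 0, 0, 1, 1, -1], [0, 1, -1, 0, 0, 0]],
    [[0, 0, 0, 0, 0, 0], [0, 0, 0, 1, 0, 0], [0, 1, 0, 0, 0, 0], [1, 0, -1, 0, 1, 0], [1, 0, 0, 0,
     0, 0], [1, 0, 0, 0, 1, -1], [1, 1, -1, 0, 0, 0]],
    [[0, 0, 0, 1, 0, 0], [1, 0, -1, 0, 1, 0], [1, 0, 0, 0, 1, -1], [1, 1, -1, 0, 0, 0], [1, 0, 0,
     0, 1, 0], [2, 0, -1, 0, 1, 0], [1, 0, 0, 1, 1, -1]],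
    [[0, 0, 0, 1, 0, 0], [0, 1, 0, 0, 0, 0], [1, 0, -1, 0, 1, 0], [1, 0, 0, 0, 1, -1], [0, 0, 0,
     1, 1, -1], [0, 1, -1, 0, 0, 0], [0, 0, 0, 0, 0, 0]],
    [[0, 0, 0, 1, 0, 0], [0, 1, 0, 0, 0, 0], [1, 0, -1, 0, 1, 0], [1, 0, 0, 0, 1, -1], [1, 1, -1,
     0, 0, 0], [1, 0, 0, 0, 1, 0], [0, 0, 0, 1, 1, -1]],
    [[0, 0, 0, 1, 0, 0], [1, 0, -1, 0, 1, 0], [1, 0, 0, 0, 0, 0], [1, 0, 0, 0, 1, -1], [1, 1, -1,
     0, 0, 0], [1, 0, 0, 0, 1, 0], [2, 0, -1, 0, 1, 0]],
    [[0, 0, 0, 1, 0, 0], [0, 1, 0, 0, 0, 0], [1, 0, -1, 0, 1, 0], [1, 0, 0, 0, 0, 0], [1, 0, 0, 0,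
     1, -1], [1, 1, -1, 0, 0, 0], [1, 0, 0, 0, 1, 0]]]"

text \<open>A list \<open>[a, b1, \<dots>, b6]\<close> stands for the barycentric coordinate \<open>x \<mapsto> a + b \<bullet> x\<close>. All entries are
  integers because the simplices are unimodular.\<close>

definition bary :: "int list list list" where
  "bary =
   [[[1, 0, -1, 0, -1, -1, 0], [0, 0, 0, 0, 1, 0, 0], [0, 0, 1, 1, 0, 1, 1], [0, 0, 0, 0, 0, 1,
     1], [0, 0, 0, 0, 0, 0, -1], [0, 1, 0, 0, 0, -1, 0], [0, -1, 0, -1, 0, 0, -1]],
    [[1, 0, -1, 0, 0, -1, 0], [0, 0, 1, 1, 0, 1, 1], [0, 0, 0, 0, 0, 1, 1], [1, 0, -1, 0, -1, -1,
     -1], [-1, 1, 1, 0, 1, 0, 0], [-1, 0, 1, 0, 1, 1, 0], [1, -1, -1, -1, -1, -1, -1]],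
    [[1, -1, -1, -1, -1, -1, -1], [0, 0, 0, 0, 1, 0, 0], [0, 0, 1, 1, 0, 1, 1], [0, 0, 0, 0, 0, 1,
     1], [0, 1, 0, 1, 0, 0, 1], [0, 0, 0, 0, 0, 0, -1], [0, 0, 0, -1, 0, -1, -1]],
    [[1, 0, -1, 0, 0, -1, 0], [0, -1, 0, -1, 0, 1, 0], [1, 0, -1, 0, -1, -1, -1], [0, 0, 1, 0, 0,
     0, 0], [0, 0, 1, 1, 0, 1, 1], [0, 1, -1, 0, 0, -1, 0], [-1, 0, 1, 0, 1, 1, 0]],
    [[0, 1, 0, 0, 1, -1, 0], [0, 0, 1, 1, 0, 1, 1], [0, 0, 0, 0, 0, 1, 1], [0, 1, 0, 0, 0, -1,
     -1], [0, -1, 0, 0, 0, 1, 0], [0, 0, 0, -1, 0, -1, -1], [1, -1, -1, 0, -1, 0, 0]],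
    [[1, 0, -1, 0, 0, -1, 0], [1, -1, 0, 0, -1, 0, 0], [1, -1, -1, -1, -1, 0, 0], [1, 0, -1, 0,
     -1, -1, -1], [-1, 1, 1, 0, 1, 0, 0], [-1, 1, 1, 1, 1, 1, 1], [-1, 0, 1, 0, 1, 1, 0]],
    [[0, 0, 0, 0, 1, 0, 0], [1, -1, -1, -1, -1, 0, 0], [1, 0, -1, 0, -1, -1, 0], [0, 0, 0, 0, 0,
     0, -1], [0, 0, 1, 0, 0, 0, 0], [0, 0, 1, 1, 0, 1, 1], [-1, 1, 0, 0, 1, 0, 0]],
    [[0, 0, 0, 0, 1, 0, 0], [1, -1, 0, 0, -1, 0, 0], [1, -1, -1, -1, -1, 0, 0], [1, 0, -1, 0, -1,
     -1, 0], [0, 0, 0, 0, 0, 0, -1], [-1, 1, 1, 0, 1, 0, 0], [-1, 1, 1, 1, 1, 1, 1]]]"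

definition auts :: "int list list list" where
  "auts =
   [[[1, 0, 0, 0, 0, 0], [0, 1, 0, 0, 0, 0], [0, 0, 1, 0, 0, 0], [0, 0, 0, 1, 0, 0], [0, 0, 0, 0,
     1, 0], [0, 0, 0, 0, 0, 1]],
    [[-1, 0, -1, 0, 0, 0], [0, -1, -1, 0, 0, 0], [0, 0, 1, 0, 0, 0], [0, 0, 1, -1, 0, 0], [0, 0,
     0, 0, -1, 0], [0, 0, -1, 0, 0, -1]],
    [[-1, 0, 0, -1, 0, 0], [0, -1, -1, -1, -1, -1], [0, 0, 0, 1, 1, 1], [0, 0, 0, 1, 0, 0], [0, 0,
     1, 0, 0, 1], [0, 0, 0, -1, 0, -1]],
    [[-1, 0, 0, 0, 0, 0], [0, -1, -1, 0, -1, 0], [0, 0, 0, 0, 1, 0], [0, 0, 0, -1, 0, -1], [0, 0,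
     1, 0, 0, 0], [0, 0, 0, 0, 0, 1]],
    [[-1, 0, 0, 0, 1, 1], [0, -1, -1, 0, 0, 0], [0, 0, 0, 0, -1, -1], [0, 0, 0, -1, -1, -1], [0,
     0, 1, 0, 0, 1], [0, 0, 0, 0, 1, 0]],
    [[-1, 0, 0, 0, 1, 0], [0, -1, 0, -1, -1, -1], [0, 0, 0, 0, 0, 1], [0, 0, -1, 0, 0, 0], [0, 0,
     0, 1, 1, 1], [0, 0, 0, 0, -1, -1]],
    [[-1, 0, 0, 0, 1, 0], [0, -1, 0, 0, -1, 0], [0, 0, 0, -1, 0, 0], [0, 0, -1, 0, 0, 0], [0, 0,
     0, 0, 1, 0], [0, 0, 0, 0, -1, -1]],
    [[1, 0, 0, 1, -1, 0], [0, 1, 0, 1, 1, 0], [0, 0, 0, -1, 0, 0], [0, 0, 1, -1, 0, 0], [0, 0, 0,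
     0, -1, 0], [0, 0, 0, 1, 1, 1]],
    [[1, 0, 0, 0, 0, 0], [0, 1, 0, 0, 0, -1], [0, 0, 1, 0, 0, 1], [0, 0, 0, 1, 0, 1], [0, 0, 0, 0,
     1, 1], [0, 0, 0, 0, 0, -1]],
    [[1, 0, 0, 1, 0, 0], [0, 1, 0, 1, 0, 0], [0, 0, 1, -1, 0, 0], [0, 0, 0, -1, 0, 0], [0, 0, 0,
     0, 1, 0], [0, 0, 0, 1, 0, 1]],
    [[1, 0, 0, 1, -1, 0], [0, 1, 0, 0, 0, 0], [0, 0, 1, 0, 1, 1], [0, 0, 0, 0, 1, 0], [0, 0, 0, 1,
     0, 0], [0, 0, 0, -1, -1, -1]],
    [[1, 0, 0, 1, 0, 1], [0, 1, 1, 0, 1, 1], [0, 0, 0, 0, -1, -1], [0, 0, 0, 0, 0, -1], [0, 0, -1,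
     1, 0, 0], [0, 0, 0, -1, 0, 0]],
    [[1, 0, 1, 0, -1, 0], [0, 1, 1, 0, 1, 0], [0, 0, -1, 1, 0, 0], [0, 0, -1, 0, 0, 0], [0, 0, 0,
     0, -1, 0], [0, 0, 1, 0, 1, 1]],
    [[1, 0, 1, 0, 0, 0], [0, 1, 0, 1, 1, 0], [0, 0, 0, 0, 0, 1], [0, 0, 0, 0, -1, 0], [0, 0, 1,
     -1, 0, 0], [0, 0, -1, 0, 0, -1]]]"

text \<open>An entry \<open>(k', n, t)\<close> in position \<open>(k, i)\<close> means that \<open>x \<mapsto> auts ! n *v x + t\<close> maps the
  neighbour of simplex \<open>k\<close> opposite to its vertex \<open>i\<close> onto simplex \<open>k'\<close>.\<close>

definition crossings :: "(nat \<times> nat \<times> int list) list list" where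
  "crossings =
   [[(1, 0, [0, 0, 0, 0, 0, 0]), (0, 9, [0, 0, 0, 0, 0, 0]), (3, 1, [1, 0, 0, 1, 1, -1]), (0, 10,
     [0, 0, 0, 0, 0, 0]), (0, 8, [0, 0, 0, 0, 0, 0]), (4, 0, [0, 0, 0, 0, 0, 0]), (2, 0, [0, 0, 0,
     0, 0, 0])],
    [(1, 3, [1, 1, -1, 0, 1, 0]), (6, 1, [1, 0, 0, 1, 1, -1]), (1, 10, [0, 0, 0, 0, 0, 0]), (1, 2,
     [1, 1, -1, 0, 1, 0]), (4, 0, [0, 0, 0, 0, 0, 0]), (0, 0, [0, 0, 0, 0, 0, 0]), (5, 0, [0, 0,
     0, 0, 0, 0])],
    [(7, 0, [0, 0, 0, 0, 0, 0]), (2, 9, [0, 0, 0, 0, 0, 0]), (3, 12, [1, 0, -1, 0, 1, 0]), (2, 10,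
     [0, 0, 0, 0, 0, 0]), (0, 0, [0, 0, 0, 0, 0, 0]), (2, 8, [0, 0, 0, 0, 0, 0]), (2, 11, [0, 0,
     0, 0, 0, 0])],
    [(2, 13, [0, -1, 0, 1, 1, -1]), (5, 5, [1, 1, 0, 0, 0, 0]), (2, 7, [0, -1, 0, 1, 1, -1]), (0,
     4, [1, 0, 0, 1, 1, -1]), (0, 1, [1, 0, 0, 1, 1, -1]), (3, 5, [1, 1, 0, 0, 0, 0]), (6, 0, [0,
     0, 0, 0, 0, 0])],
    [(4, 5, [0, 1, 0, 0, 0, 0]), (5, 12, [1, 0, -1, 0, 1, 0]), (4, 10, [0, 0, 0, 0, 0, 0]), (4, 6,
     [0, 1, 0, 0, 0, 0]), (0, 0, [0, 0, 0, 0, 0, 0]), (4, 11, [0, 0, 0, 0, 0, 0]), (1, 0, [0, 0,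
     0, 0, 0, 0])],
    [(4, 13, [0, -1, 0, 1, 1, -1]), (3, 5, [1, 1, 0, 0, 0, 0]), (6, 5, [1, 1, 0, 0, 0, 0]), (4, 7,
     [0, -1, 0, 1, 1, -1]), (1, 11, [0, 0, 0, 0, 0, 0]), (1, 0, [0, 0, 0, 0, 0, 0]), (7, 0, [0, 0,
     0, 0, 0, 0])],
    [(6, 9, [0, 0, 0, 0, 0, 0]), (5, 5, [1, 1, 0, 0, 0, 0]), (3, 0, [0, 0, 0, 0, 0, 0]), (6, 8,
     [0, 0, 0, 0, 0, 0]), (1, 4, [1, 0, 0, 1, 1, -1]), (1, 1, [1, 0, 0, 1, 1, -1]), (7, 0, [0, 0,
     0, 0, 0, 0])],
    [(7, 9, [0, 0, 0, 0, 0, 0]), (6, 0, [0, 0, 0, 0, 0, 0]), (7, 5, [1, 1, 0, 0, 0, 0]), (5, 0,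
     [0, 0, 0, 0, 0, 0]), (7, 8, [0, 0, 0, 0, 0, 0]), (2, 11, [0, 0, 0, 0, 0, 0]), (2, 0, [0, 0,
     0, 0, 0, 0])]]"

text \<open>Circumcentres, scaled by \<open>10 ^ 9\<close> and rounded.\<close>

definition centers :: "int list list" where
  "centers =
   [[376652965, 357315895, -343691533, 227690143, 312616934, -227690143],
    [371022187, 353381428, -343691533, 285690838, 370617629, -285690838],
    [589734676, 340193127, -343691533, 51314431, 312616934, -51314431],
    [958793772, 65541435, -343691533, 343691533, 687383066, -343691533],
    [306581597, 304945977, -285690838, 285690838, 370617629, -285690838],
    [658517926, 310706971, -343691533, 285690838, 629382371, -285690838],
    [964424550, 69475902, -343691533, 285690838, 629382371, -285690838],
    [681271472, 326605854, -343691533, 51314431, 395005965, -51314431]]"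

section \<open>The form in integers and the checks of the tables\<close>

definition qint :: "int list \<Rightarrow> int" where
  "qint xs = dot xs (mv gram xs)"

definition Q0 :: "real ^ 6 ^ 6" where
  "Q0 = (1 / 10 ^ 14) *\<^sub>R imat gram"

text \<open>The three coefficients have 14 decimals, so scaling by \<open>10 ^ 14\<close> represents
  the form exactly.\<close>

lemma Q0_eq:
  "Q_E6_dual + 0.15266328480099 *\<^sub>R R2 + 0.32884740614948 *\<^sub>R R3 + 0.13827491241153 *\<^sub>R R4 = Q0"
  unfolding Q0_def imat_def Q_E6_dual_def R2_def R3_def R4_def gram_def
  by (simp add: vec_eq_iff forall_6 vector_6 idx_simps)

lemma square6_gram: "square6 gram"
  by code_simp

lemma length_mv: "length (mv A xs) = length A"
  by (simp add: mv_def)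

lemma qval_Q0: "length xs = 6 \<Longrightarrow> qval Q0 (ivec xs) = real_of_int (qint xs) / 10 ^ 14"
  using square6_gram
  by (simp add: Q0_def qval_def scaleR_matrix_vector_assoc[symmetric] imat_ivec inner_ivec qint_def
      length_mv square6_def)

text \<open>With a 1 prepended to each vertex, the coordinate table and the vertex table are inverse
  up to transposition. The column products give \<open>lam_sum\<close> and \<open>lam_vert\<close>,
  the row products give \<open>lam_delta\<close>.\<close>

definition simplex_ok :: "nat \<Rightarrow> bool" where
  "simplex_ok k \<longleftrightarrow> (let V = verts ! k; B = bary ! k; V1 = map ((#) 1) V in
     length V = 7 \<and> length B = 7 \<and> (\<forall>v\<in>set V. length v = 6) \<and> (\<forall>b\<in>set B. length b = 7) \<and>
     map (\<lambda>m. map (\<lambda>l. dot (col m B) (col l V1)) [0..<7]) [0..<7]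
       = map (\<lambda>m. map (\<lambda>l. of_bool (m = l)) [0..<7]) [0..<7] \<and>
     map (\<lambda>b. map (dot b) V1) B = map (\<lambda>m. map (\<lambda>l. of_bool (m = l)) [0..<7]) [0..<7])"

text \<open>\<open>W\<close> lists the moved vertices of simplex \<open>k\<close>. The last conjunct
  is positivity of \<open>pow k'\<close> at the moved vertex \<open>i\<close>, multiplied by
  \<open>10 ^ 14\<close>.\<close>

definition crossing_ok :: "nat \<Rightarrow> nat \<Rightarrow> bool" where
  "crossing_ok k i \<longleftrightarrow> (case crossings ! k ! i of (k', n, t) \<Rightarrow>
     let W = map (\<lambda>v. map2 (+) (mv (auts ! n) v) t) (verts ! k) in
     k' < 8 \<and> n < 14 \<and> length t = 6 \<and>
     (\<forall>j\<in>set [0..<7]. j \<noteq> i \<longrightarrow> W ! j \<in> set (verts ! k')) \<and>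
     dot (map (\<lambda>b. dot b (1 # W ! i)) (bary ! k')) (map qint (verts ! k')) < qint (W ! i))"

text \<open>Entry \<open>(a, b)\<close> of the computed list pairs column \<open>b\<close> of
  \<open>g\<close> with \<open>gram\<close> times column \<open>a\<close>, so it is the transposed
  congruence; symmetry of \<open>gram\<close> repairs the order later.\<close>

definition aut_ok :: "int list list \<Rightarrow> bool" where
  "aut_ok g \<longleftrightarrow> square6 g \<and> (let C = map (\<lambda>l. col l g) [0..<6] in
     map (\<lambda>c. mv C (mv gram c)) C = gram)"

definition radius_ok :: "nat \<Rightarrow> bool" where
  "radius_ok k \<longleftrightarrow> length (centers ! k) = 6 \<and>
     (\<forall>v\<in>set (verts ! k). qint (map2 (-) (map ((*) (10 ^ 9)) v) (centers ! k)) \<le> 36399223 * 10 ^ 25)"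

lemma auts_ok: "list_all aut_ok auts"
  by code_simp

lemma simplices_ok: "list_all simplex_ok [0..<8]"
  by code_simp

lemma crossings_ok: "list_all (\<lambda>k. list_all (crossing_ok k) [0..<7]) [0..<8]"
  by code_simp

lemma radii_ok: "list_all radius_ok [0..<8]"
  by code_simp

section \<open>Transfer of the checks to real vectors and matrices\<close>

lemma crossing_data:
  assumes "k < 8" "i < 7"
  shows "crossing_ok k i"
  using crossings_ok assms by (simp add: list_all_iff)

lemma auts_integral:
  assumes "n < 14"
  shows "square6 (auts ! n)" "imat (auts ! n) \<in> integral_auts Q0"
proof -
  define g where "g = auts ! n"
  have "length auts = 14"
    by (simp add: auts_def)
  then have ok: "aut_ok g"
    using auts_ok assms by (simp add: list_all_iff g_def)
  then show sq: "square6 (auts ! n)"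
    by (simp add: aut_ok_def g_def)
  have cols: "map (\<lambda>c. mv (map (\<lambda>l. col l g) [0..<6]) (mv gram c)) (map (\<lambda>l. col l g) [0..<6]) = gram"
    using ok by (simp only: aut_ok_def Let_def)
  have entry: "gram ! a ! b = (\<Sum>m<6. g ! m ! b * (\<Sum>l<6. gram ! m ! l * g ! l ! a))"
    if "a < 6" "b < 6" for a b
  proof -
    have "gram ! a ! b = dot (col b g) (mv gram (col a g))"
      using arg_cong[OF cols, of "\<lambda>M. M ! a ! b"] that by (simp add: mv_def)
    then show ?thesis
      using sq square6_gram that
      by (simp add: dot_nth[where n = 6] square6_def col_def mv_def g_def)
  qed
  have gram_sym: "gram ! a ! b = gram ! b ! a" if "a < 6" "b < 6" for a b
  proof -
    have "list_all (\<lambda>a. list_all (\<lambda>b. gram ! a ! b = gram ! b ! a) [0..<6]) [0..<6]"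
      by code_simp
    with that show ?thesis
      by (simp add: list_all_iff)
  qed
  have "transpose (imat g) ** imat gram ** imat g = imat gram"
  proof -
    have "(transpose (imat g) ** imat gram ** imat g) $ i $ j = imat gram $ i $ j" for i j
    proof -
      have "(transpose (imat g) ** (imat gram ** imat g)) $ i $ j
        = real_of_int (\<Sum>m<6. g ! m ! idx i * (\<Sum>l<6. gram ! m ! l * g ! l ! idx j))"
        by (simp add: matrix_matrix_mult_def transpose_def imat_def
            sum_idx[of "\<lambda>l. real_of_int (gram ! _ ! l) * real_of_int (g ! l ! _)"]
            sum_idx[of "\<lambda>m. real_of_int (g ! m ! _) * (\<Sum>l<6. real_of_int (gram ! m ! l) * real_of_int (g ! l ! _))"])
      then show ?thesis
        using entry[of "idx j" "idx i"] gram_sym[of "idx i" "idx j"] idx_less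
        by (simp add: matrix_mul_assoc imat_def)
    qed
    then show ?thesis
      by (simp add: vec_eq_iff)
  qed
  then have "transpose (imat g) ** Q0 ** imat g = Q0"
    by (simp add: Q0_def matrix_scalar_ac scalar_matrix_assoc[symmetric])
  then show "imat (auts ! n) \<in> integral_auts Q0"
    by (simp add: integral_auts_def imat_def g_def)
qed

definition coord0 :: "nat \<Rightarrow> nat \<Rightarrow> real" where
  "coord0 k j = real_of_int (bary ! k ! j ! 0)"

definition coord1 :: "nat \<Rightarrow> nat \<Rightarrow> real ^ 6" where
  "coord1 k j = ivec (tl (bary ! k ! j))"

definition vertex :: "nat \<Rightarrow> nat \<Rightarrow> real ^ 6" where
  "vertex k j = ivec (verts ! k ! j)"

lemma simplex_data:
  assumes "k < 8"
  shows "length (verts ! k) = 7" "length (bary ! k) = 7"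
    and length_verts: "j < 7 \<Longrightarrow> length (verts ! k ! j) = 6"
    and length_bary: "j < 7 \<Longrightarrow> length (bary ! k ! j) = 7"
    and bary_cols: "m < 7 \<Longrightarrow> l < 7 \<Longrightarrow>
      (\<Sum>j<7. bary ! k ! j ! m * (1 # verts ! k ! j) ! l) = of_bool (m = l)"
    and bary_rows: "i < 7 \<Longrightarrow> j < 7 \<Longrightarrow> dot (bary ! k ! i) (1 # verts ! k ! j) = of_bool (i = j)"
proof -
  have ok: "simplex_ok k"
    using simplices_ok assms by (simp add: list_all_iff)
  then show len: "length (verts ! k) = 7" "length (bary ! k) = 7"
    by (simp_all add: simplex_ok_def Let_def)
  show "j < 7 \<Longrightarrow> length (verts ! k ! j) = 6" "j < 7 \<Longrightarrow> length (bary ! k ! j) = 7"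
    using ok by (simp_all add: simplex_ok_def Let_def)
  have cols: "map (\<lambda>m. map (\<lambda>l. dot (col m (bary ! k)) (col l (map ((#) 1) (verts ! k)))) [0..<7]) [0..<7]
       = map (\<lambda>m. map (\<lambda>l. of_bool (m = l)) [0..<7]) [0..<7]"
    and rows: "map (\<lambda>b. map (dot b) (map ((#) 1) (verts ! k))) (bary ! k)
       = map (\<lambda>m. map (\<lambda>l. of_bool (m = l)) [0..<7]) [0..<7]"
    using ok by (simp_all only: simplex_ok_def Let_def)
  show "(\<Sum>j<7. bary ! k ! j ! m * (1 # verts ! k ! j) ! l) = of_bool (m = l)" if "m < 7" "l < 7"
    using arg_cong[OF cols, of "\<lambda>M. M ! m ! l"] that len by (simp add: dot_nth[where n = 7] col_def)
  show "dot (bary ! k ! i) (1 # verts ! k ! j) = of_bool (i = j)" if "i < 7" "j < 7"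
    using arg_cong[OF rows, of "\<lambda>M. M ! i ! j"] that len by simp
qed

lemma coord_ivec:
  assumes "k < 8" "j < 7" "length xs = 6"
  shows "coord0 k j + coord1 k j \<bullet> ivec xs = real_of_int (dot (bary ! k ! j) (1 # xs))"
proof -
  obtain b bs where b: "bary ! k ! j = b # bs" "length bs = 6"
    using length_bary[OF assms(1,2)] by (cases "bary ! k ! j") auto
  then show ?thesis
    using assms(3) by (simp add: coord0_def coord1_def inner_ivec) (simp add: dot_def)
qed

lemma coord_expand:
  assumes "k < 8" "j < 7"
  shows "coord0 k j + coord1 k j \<bullet> y
    = real_of_int (bary ! k ! j ! 0) + (\<Sum>i\<in>UNIV. real_of_int (bary ! k ! j ! Suc (idx i)) * y $ i)"
  using length_bary[OF assms] idx_less
  by (simp add: coord0_def coord1_def inner_vec_def ivec_def nth_tl)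

lemma Suc_idx_less: "Suc (idx i) < 7"
  using idx_less[of i] by simp

text \<open>Component \<open>l\<close> of the identity that the coordinates reproduce the vector (1,
  y): \<open>l = 0\<close> gives their sum 1, the other \<open>l\<close> give the components of
  \<open>y\<close>. It rests on \<open>bary_cols\<close>.\<close>

lemma coord_moment:
  assumes "k < 8" "l < 7"
  shows "(\<Sum>j<7. (coord0 k j + coord1 k j \<bullet> y) * real_of_int ((1 # verts ! k ! j) ! l))
    = of_bool (l = 0) + (\<Sum>i\<in>UNIV. of_bool (Suc (idx i) = l) * y $ i)"
proof -
  have *: "(\<Sum>j<7. real_of_int (bary ! k ! j ! m) * real_of_int ((1 # verts ! k ! j) ! l))
      = of_bool (m = l)" if "m < 7" for m
    using arg_cong[OF bary_cols[OF assms(1) that assms(2)], of real_of_int] by simp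
  have "(\<Sum>j<7. (coord0 k j + coord1 k j \<bullet> y) * real_of_int ((1 # verts ! k ! j) ! l))
      = (\<Sum>j<7. real_of_int (bary ! k ! j ! 0) * real_of_int ((1 # verts ! k ! j) ! l)
        + (\<Sum>i\<in>UNIV. real_of_int (bary ! k ! j ! Suc (idx i)) * real_of_int ((1 # verts ! k ! j) ! l) * y $ i))"
    using coord_expand[OF assms(1)]
    by (intro sum.cong) (simp_all add: algebra_simps sum_distrib_left)
  also have "\<dots> = (\<Sum>j<7. real_of_int (bary ! k ! j ! 0) * real_of_int ((1 # verts ! k ! j) ! l))
        + (\<Sum>i\<in>UNIV. (\<Sum>j<7. real_of_int (bary ! k ! j ! Suc (idx i)) * real_of_int ((1 # verts ! k ! j) ! l)) * y $ i)"
    unfolding sum.distrib sum_distrib_right by (subst sum.swap) simp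
  also have "\<dots> = of_bool (0 = l) + (\<Sum>i\<in>UNIV. of_bool (Suc (idx i) = l) * y $ i)"
    by (simp only: *[of 0] *[of "Suc (idx _)"] idx_less Suc_idx_less zero_less_numeral)
  finally show ?thesis by (simp only: eq_commute[of 0 l])
qed

section \<open>Positive definiteness and determinant\<close>

text \<open>Elimination takes the pivots in the order 6, 1, 2, 3, 4, 5: in the order of the type
  \<^typ>\<open>6\<close> the element 6 is the same as 0, hence the least one, so that the factor is upper
  triangular.\<close>

definition ldl_factor :: "real ^ 6 ^ 6" where
  "ldl_factor = vector
    [vector [90879614593440423689833430164, 31312021259108120101178717222,
      40730545284182847930337382462, 40730545284182847930337382462,
      -29783796667166151794327356471, 0],
     vector [0, 6, 2, 2, 3, 0],
     vector [0, 0, 2, -1, 0, 0],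
     vector [0, 0, 0, 1, 0, 0],
     vector [0, 0, 0, 0, 1, 0],
     vector [179596972471049, 227748041566096, 389726601902296, 389726601902296, 404992930382395,
      761834791669743]]"

text \<open>The rows of \<open>ldl_factor\<close> are cleared of denominators, so each weight is a
  pivot of \<open>Q0\<close> divided by the square of the diagonal entry in that row.\<close>

definition ldl_weight :: "real ^ 6" where
  "ldl_weight = (1 / 10 ^ 14) *\<^sub>R vector
    [5 / 69235252250820220869350269777104146742327852,
     5609215228681043258331181136161096485484945 / 272638843780321271069500290492,
     566971490718595 / 6,
     566971490718595 / 2,
     566971490718595 / 2,
     1 / 761834791669743]"

definition ldl_diag :: "real ^ 6 ^ 6" where
  "ldl_diag = (\<chi> i j. if i = j then ldl_weight $ i else 0)"

lemma ldl_weight_pos: "ldl_weight $ i > 0"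
proof -
  have "\<forall>i. ldl_weight $ i > 0"
    by (simp add: forall_6 ldl_weight_def vector_6)
  then show ?thesis ..
qed

lemma Q0_ldl: "Q0 = transpose ldl_factor ** ldl_diag ** ldl_factor"
proof -
  have "(transpose ldl_factor ** ldl_diag ** ldl_factor) $ i $ j
      = (\<Sum>k\<in>UNIV. ldl_weight $ k * (ldl_factor $ k $ i * ldl_factor $ k $ j))" for i j
    by (simp add: matrix_matrix_mult_def transpose_def ldl_diag_def if_distrib mult_ac cong: if_cong)
  moreover have "\<forall>i j. Q0 $ i $ j = (\<Sum>k\<in>UNIV. ldl_weight $ k * (ldl_factor $ k $ i * ldl_factor $ k $ j))"
    by (simp add: forall_6 sum_6 Q0_def imat_def gram_def ldl_weight_def ldl_factor_def vector_6 idx_simps)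
  ultimately show ?thesis
    by (simp add: vec_eq_iff)
qed

lemma det_ldl_factor: "det ldl_factor = (\<Prod>i\<in>UNIV. ldl_factor $ i $ i)"
proof (rule det_upperdiagonal)
  have "\<forall>i j. j < i \<longrightarrow> ldl_factor $ i $ j = 0"
    by (simp add: forall_6 less_bit0_def bit0.Rep_numeral bit0.Rep_1 bit0.Rep_0 ldl_factor_def vector_6)
  then show "\<And>i j. j < i \<Longrightarrow> ldl_factor $ i $ j = 0" by blast
qed

lemma pqf_Q0: "pqf Q0"
proof -
  have "transpose ldl_diag = ldl_diag"
    by (simp add: ldl_diag_def transpose_def vec_eq_iff)
  then have "transpose Q0 = Q0"
    by (simp add: Q0_ldl matrix_transpose_mul matrix_mul_assoc)
  moreover have "0 < x \<bullet> (Q0 *v x)" if "x \<noteq> 0" for x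
  proof -
    define z where "z = ldl_factor *v x"
    \<comment> \<open>Invertibility makes some coordinate of \<open>z\<close> nonzero, and
      \<open>Q0\<close> is a sum of squares of these coordinates with positive weights.\<close>
    have "det ldl_factor \<noteq> 0"
      unfolding det_ldl_factor by (simp add: prod_6 ldl_factor_def vector_6)
    then have "z \<noteq> 0"
      using that invertible_det_nz matrix_left_invertible_ker[of ldl_factor]
      unfolding z_def invertible_def by blast
    then obtain k where k: "z $ k \<noteq> 0"
      by (auto simp: vec_eq_iff)
    have "x \<bullet> (Q0 *v x) = x \<bullet> (transpose ldl_factor *v (ldl_diag *v z))"
      by (simp only: Q0_ldl z_def matrix_vector_mul_assoc matrix_mul_assoc)
    also have "\<dots> = (ldl_diag *v z) \<bullet> z"
      by (simp only: inner_commute[of x] transpose_matrix_vector dot_lmul_matrix z_def)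
    also have "\<dots> = (\<Sum>i\<in>UNIV. ldl_weight $ i * (z $ i)\<^sup>2)"
      by (simp add: inner_vec_def matrix_vector_mult_def ldl_diag_def if_distrib if_distribR
          power2_eq_square mult_ac cong: if_cong)
    also have "\<dots> > 0"
      using k ldl_weight_pos by (intro sum_pos2[of _ k]) (auto simp: less_imp_le)
    finally show ?thesis .
  qed
  ultimately show ?thesis
    by (simp add: pqf_def)
qed

text \<open>The determinant is the product of the pivots. It is bounded from below because it stands
  in the denominator of the density.\<close>

lemma det_Q0: "det Q0 > 10223.17439276776"
proof -
  have "det ldl_diag = (\<Prod>i\<in>UNIV. ldl_weight $ i)"
    by (subst det_diagonal) (auto simp: ldl_diag_def)
  then have "det Q0 = (\<Prod>i\<in>UNIV. (ldl_factor $ i $ i)\<^sup>2 * ldl_weight $ i)"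
    by (simp add: Q0_ldl det_mul det_ldl_factor prod.distrib power2_eq_square)
  also have "\<dots> > 10223.17439276776"
    by (simp add: prod_6 ldl_weight_def ldl_factor_def vector_6 power2_eq_square)
  finally show ?thesis .
qed

section \<open>The covering density\<close>

interpretation delone: simplex_system Q0 "{..<8}" "{..<7}" vertex coord0 coord1
  "\<lambda>k j y. coord0 k j + coord1 k j \<bullet> y"
  "\<lambda>k y. qval Q0 y - (\<Sum>j<7. (coord0 k j + coord1 k j \<bullet> y) * qval Q0 (vertex k j))"
proof (unfold_locales)
  fix k assume "k \<in> {..<8::nat}"
  then have k: "k < 8" by simp
  show "(\<Sum>j<7. coord0 k j + coord1 k j \<bullet> y) = 1" for y
    using coord_moment[OF k, of 0 y] by simp
  show "(\<Sum>j<7. (coord0 k j + coord1 k j \<bullet> y) *\<^sub>R vertex k j) = y" for y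
  proof -
    have "(\<Sum>j<7. (coord0 k j + coord1 k j \<bullet> y) * real_of_int (verts ! k ! j ! idx l)) = y $ l" for l
      using coord_moment[OF k, of "Suc (idx l)" y] idx_less[of l] by (simp add: idx_inj)
    then show ?thesis
      by (simp add: vec_eq_iff vertex_def ivec_def)
  qed
  show "coord0 k i + coord1 k i \<bullet> vertex k j = of_bool (i = j)"
    if "i \<in> {..<7}" "j \<in> {..<7}" for i j
    using that k by (simp add: vertex_def coord_ivec length_verts bary_rows)
  show "\<exists>k'\<in>{..<8}. \<exists>g\<in>integral_auts Q0. \<exists>t\<in>int_lattice.
      (\<forall>j\<in>{..<7} - {i}. g *v vertex k j + t \<in> vertex k' ` {..<7}) \<and>
      0 < qval Q0 (g *v vertex k i + t)
        - (\<Sum>j<7. (coord0 k' j + coord1 k' j \<bullet> (g *v vertex k i + t)) * qval Q0 (vertex k' j))"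
    if "i \<in> {..<7}" for i
  proof -
    obtain k' n t where c: "crossings ! k ! i = (k', n, t)"
      by (cases "crossings ! k ! i")
    define W where "W = map (\<lambda>v. map2 (+) (mv (auts ! n) v) t) (verts ! k)"
    have ok: "k' < 8" "n < 14" "length t = 6"
      "\<And>j. j < 7 \<Longrightarrow> j \<noteq> i \<Longrightarrow> W ! j \<in> set (verts ! k')"
      "dot (map (\<lambda>b. dot b (1 # W ! i)) (bary ! k')) (map qint (verts ! k')) < qint (W ! i)"
      using crossing_data[OF k, of i] that by (simp_all add: crossing_ok_def c W_def Let_def)
    have image: "imat (auts ! n) *v vertex k j + ivec t = ivec (W ! j)" "length (W ! j) = 6"
      if "j < 7" for j
      using that k ok(3) auts_integral(1)[OF ok(2)]
      by (simp_all add: W_def vertex_def simplex_data(1) length_verts imat_ivec ivec_add length_mv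
          square6_def)
    have i: "i < 7"
      using that by simp
    have "(\<Sum>j<7. (coord0 k' j + coord1 k' j \<bullet> ivec (W ! i)) * qval Q0 (vertex k' j))
        = real_of_int (\<Sum>j<7. dot (bary ! k' ! j) (1 # W ! i) * qint (verts ! k' ! j)) / 10 ^ 14"
      using image(2)[OF i] ok(1)
      by (simp add: coord_ivec vertex_def qval_Q0 length_verts sum_divide_distrib)
    also have "\<dots> < qval Q0 (ivec (W ! i))"
      using ok(5) image(2)[OF i] simplex_data(1,2)[OF ok(1)]
      by (simp add: dot_nth[where n = 7] qval_Q0 divide_strict_right_mono flip: of_int_mult of_int_sum)
    finally have pos: "0 < qval Q0 (ivec (W ! i))
        - (\<Sum>j<7. (coord0 k' j + coord1 k' j \<bullet> ivec (W ! i)) * qval Q0 (vertex k' j))"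
      by simp
    have "ivec (W ! j) \<in> vertex k' ` {..<7}" if "j < 7" "j \<noteq> i" for j
      using ok(4)[OF that] simplex_data(1)[OF ok(1)]
      by (simp add: in_set_conv_nth vertex_def image_iff) (metis lessThan_iff)
    then show ?thesis
      using ok(1) pos image(1) i ivec_int_lattice auts_integral(2)[OF ok(2)]
      by (intro bexI[of _ k'] bexI[of _ "imat (auts ! n)"] bexI[of _ "ivec t"]) auto
  qed
qed (auto simp: pqf_Q0 vertex_def ivec_int_lattice lessThan_empty_iff)

lemma radius_bound:
  assumes "k < 8" "j < 7"
  shows "qval Q0 (vertex k j - (1 / 10 ^ 9) *\<^sub>R ivec (centers ! k)) \<le> 3.6399223"
proof -
  have ok: "length (centers ! k) = 6"
    "qint (map2 (-) (map ((*) (10 ^ 9)) (verts ! k ! j)) (centers ! k)) \<le> 36399223 * 10 ^ 25"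
    using radii_ok assms by (auto simp: list_all_iff radius_ok_def simplex_data)
  have "real_of_int (10 ^ 9) *\<^sub>R vertex k j - ivec (centers ! k)
      = ivec (map2 (-) (map ((*) (10 ^ 9)) (verts ! k ! j)) (centers ! k))" (is "_ = ivec ?d")
    using ivec_scale[of "verts ! k ! j" "10 ^ 9"] assms ok(1)
      ivec_diff[of "map ((*) (10 ^ 9)) (verts ! k ! j)" "centers ! k"]
    by (simp add: vertex_def length_verts)
  moreover have "vertex k j - (1 / 10 ^ 9) *\<^sub>R ivec (centers ! k)
      = (1 / 10 ^ 9) *\<^sub>R (real_of_int (10 ^ 9) *\<^sub>R vertex k j - ivec (centers ! k))"
    by (simp add: scaleR_diff_right)
  ultimately have "vertex k j - (1 / 10 ^ 9) *\<^sub>R ivec (centers ! k) = (1 / 10 ^ 9) *\<^sub>R ivec ?d"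
    by (simp only:)
  \<comment> \<open>The denominator combines \<open>10 ^ 14\<close> from \<open>gram\<close> with
    the square of \<open>10 ^ 9\<close> from the centres.\<close>
  then have "qval Q0 (vertex k j - (1 / 10 ^ 9) *\<^sub>R ivec (centers ! k)) = real_of_int (qint ?d) / 10 ^ 32"
    using assms ok(1) by (simp add: qval_scaleR qval_Q0 length_verts power_divide)
  also have "\<dots> \<le> real_of_int (36399223 * 10 ^ 25) / 10 ^ 32"
    using ok(2) by (intro divide_right_mono) (simp_all only: of_int_le_iff, simp)
  finally show ?thesis by simp
qed

lemma inhomogeneous_min_Q0: "0 \<le> inhomogeneous_min Q0" "inhomogeneous_min Q0 \<le> 3.6399223"
proof -
  have "\<exists>u\<in>int_lattice. qval Q0 (x - u) \<le> 3.6399223" for x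
    using delone.near_int_lattice[of "\<lambda>k. (1 / 10 ^ 9) *\<^sub>R ivec (centers ! k)" "3.6399223" x]
      radius_bound by (metis lessThan_iff)
  then show "0 \<le> inhomogeneous_min Q0" "inhomogeneous_min Q0 \<le> 3.6399223"
    using inhomogeneous_min_bounds[OF pqf_Q0] by blast+
qed

lemma covering_density_Q0: "covering_density Q0 \<le> 2.464801"
proof -
  have "inhomogeneous_min Q0 ^ 6 / det Q0 \<le> 3.6399223 ^ 6 / 10223.17439276776"
    using inhomogeneous_min_Q0 det_Q0 by (intro frac_le power_mono) auto
  \<comment> \<open>The root is rounded up in the eighth decimal; multiplied by the volume of the
    unit ball it stays just below the target.\<close>
  also have "\<dots> \<le> 0.47696167\<^sup>2"
    by (simp add: power2_eq_square eval_nat_numeral)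
  finally have root: "sqrt (inhomogeneous_min Q0 ^ 6 / det Q0) \<le> 0.47696167"
    by (intro real_le_lsqrt) auto
  have "pi ^ 3 \<le> 3.1415926535899 ^ 3"
    using pi_approx(2) by (intro power_mono) auto
  then have vol: "0.47696167 * (pi ^ 3 / 6) \<le> 2.464801"
    by (simp add: power3_eq_cube)
  have "measure lborel (cball (0 :: real ^ 6) 1) = pi ^ 3 / 6"
    using content_cball[of 1 "0 :: real ^ 6"] unit_ball_vol_even[of 3] by (simp add: fact_numeral)
  then have "covering_density Q0 = sqrt (inhomogeneous_min Q0 ^ 6 / det Q0) * (pi ^ 3 / 6)"
    unfolding covering_density_def by simp
  also have "\<dots> \<le> 0.47696167 * (pi ^ 3 / 6)"
    using root by (intro mult_right_mono) auto
  finally show ?thesis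
    using vol by linarith
qed

theorem theorem11p8:
  fixes Q6_c1 :: "real ^ 6 ^ 6"
  assumes "is_Q6_c1 Q6_c1"
  shows "covering_density Q6_c1 \<le> 2.464801"
proof -
  \<comment> \<open>By \<open>Q0_eq\<close>, \<open>D_c1\<close> unfolds to \<open>Del Q0\<close>,
    so only positive definiteness remains.\<close>
  have "Q0 \<in> secondary_cone D_c1"
    unfolding secondary_cone_def D_c1_def Q0_eq using pqf_Q0 by blast
  then have "Q0 \<in> closure (secondary_cone D_c1)"
    using closure_subset by blast
  then have "covering_density Q6_c1 \<le> covering_density Q0"
    using assms pqf_Q0 by (simp add: is_Q6_c1_def is_arg_min_linorder)
  with covering_density_Q0 show ?thesis by linarith
qed

end
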